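(* Let $\mathcal{H}$ be a complex Hilbert space, $A\in\mathcal{B}(\mathcal{H})$ a positive operator, and let $T,S\in\mathcal{B}_{A^{1/2}}(\mathcal{H})$ be such that $TS=ST$. Then $$r_A(TS)\leq\frac12\left[\omega_A(TS)+\|T\|_A^{1/2}\|S\|_A^{1/2}\|TS\|_A^{1/2}\right]$$ and $$r_A(TS)\leq\frac12\left[\omega_A(TS)+\min\left\{\|T\|_A\|S^2\|_A^{1/2},\ \|T^2\|_A^{1/2}\|S\|_A\right\}\right].$$
   Context: $\mathcal{B}(\mathcal{H})$ is the algebra of bounded linear operators on the complex Hilbert space $(\mathcal{H},\langle\cdot\mid\cdot\rangle)$. For positive $A$, put $\langle x\mid y\rangle_A=\langle Ax\mid y\rangle$ and $\|x\|_A=\langle x\mid x\rangle_A^{1/2}=\|A^{1/2}x\|$. $\mathcal{B}_{A^{1/2}}(\mathcal{H})$ is the set of $T\in\mathcal{B}(\mathcal{H})$ for which there is $\lambda>0$ with $\|Tx\|_A\le\lambda\|x\|_A$ for all $x\in\mathcal{H}$ ($A$-bounded operators). For such $T$, $\|T\|_A=\sup\{\|Tx\|_A: x\in\mathcal{H},\ \|x\|_A=1\}$, the $A$-numerical radius is $\omega_A(T)=\sup\{|\langle Tx\mid x\rangle_A|: x\in\mathcal{H},\ \|x\|_A=1\}$ (suprema over the empty set, occurring only if $A=0$, are $0$), and the $A$-spectral radius is $r_A(T)=\inf_{n\ge1}\|T^n\|_A^{1/n}=\lim_{n\to\infty}\|T^n\|_A^{1/n}$. *)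

theory Defs
  imports "HOL-Analysis.Analysis"
begin

text \<open>
  Complex Hilbert spaces, as types. The inner product is linear in the first argument. The axiom
  \<open>cinner_self\<close> states that the norm is the one induced by the inner product; as it is an equation
  between complex numbers, it also contains positive definiteness. Completeness is inherited
  from class \<open>banach\<close>.
\<close>

class chilbert_space = banach +
  fixes scaleC :: "complex \<Rightarrow> 'a \<Rightarrow> 'a" (infixr "*\<^sub>C" 75)
    and cinner :: "'a \<Rightarrow> 'a \<Rightarrow> complex"
  assumes scaleC_add_right: "c *\<^sub>C (x + y) = c *\<^sub>C x + c *\<^sub>C y"
    and scaleC_add_left: "(c + d) *\<^sub>C x = c *\<^sub>C x + d *\<^sub>C x"
    and scaleC_scaleC: "c *\<^sub>C (d *\<^sub>C x) = (c * d) *\<^sub>C x"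
    and scaleR_scaleC: "scaleR r x = complex_of_real r *\<^sub>C x"
    and cinner_commute: "cinner x y = cnj (cinner y x)"
    and cinner_add_left: "cinner (x + y) z = cinner x z + cinner y z"
    and cinner_scaleC_left: "cinner (c *\<^sub>C x) y = c * cinner x y"
    and cinner_self: "cinner x x = complex_of_real ((norm x)\<^sup>2)"

instantiation complex :: chilbert_space
begin

definition scaleC_complex :: "complex \<Rightarrow> complex \<Rightarrow> complex"
  where "scaleC_complex c x = c * x"

definition cinner_complex :: "complex \<Rightarrow> complex \<Rightarrow> complex"
  where "cinner_complex x y = x * cnj y"

instance
  by standard
    (simp_all add: scaleC_complex_def cinner_complex_def algebra_simps scaleR_conv_of_real
      complex_norm_square del: of_real_power)

end

definition bounded_operator :: "('h::chilbert_space \<Rightarrow> 'h) \<Rightarrow> bool"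
  where "bounded_operator T \<longleftrightarrow> bounded_linear T \<and> (\<forall>c x. T (c *\<^sub>C x) = c *\<^sub>C T x)"

definition positive_operator :: "('h::chilbert_space \<Rightarrow> 'h) \<Rightarrow> bool"
  where "positive_operator A \<longleftrightarrow>
    bounded_operator A \<and> (\<forall>x. cinner (A x) x \<in> \<real>\<^sub>\<ge>\<^sub>0)"

definition A_inner :: "('h::chilbert_space \<Rightarrow> 'h) \<Rightarrow> 'h \<Rightarrow> 'h \<Rightarrow> complex"
  where "A_inner A x y = cinner (A x) y"

text \<open>For positive \<open>A\<close> the value \<open>A_inner A x x\<close> is a nonnegative real, so \<open>Re\<close> loses nothing.\<close>

definition A_seminorm :: "('h::chilbert_space \<Rightarrow> 'h) \<Rightarrow> 'h \<Rightarrow> real"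
  where "A_seminorm A x = sqrt (Re (A_inner A x x))"

definition A_bounded :: "('h::chilbert_space \<Rightarrow> 'h) \<Rightarrow> ('h \<Rightarrow> 'h) \<Rightarrow> bool"
  where "A_bounded A T \<longleftrightarrow> bounded_operator T \<and>
    (\<exists>c>0. \<forall>x. A_seminorm A (T x) \<le> c * A_seminorm A x)"

text \<open>
  The \<open>A\<close>-unit sphere is empty exactly if \<open>A = 0\<close>. Suprema over the empty set are \<open>0\<close> by
  convention, whereas \<open>Sup {}\<close> has no specified value on type \<open>real\<close>.
\<close>

definition sup0 :: "real set \<Rightarrow> real"
  where "sup0 X = (if X = {} then 0 else Sup X)"

definition A_opnorm :: "('h::chilbert_space \<Rightarrow> 'h) \<Rightarrow> ('h \<Rightarrow> 'h) \<Rightarrow> real"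
  where "A_opnorm A T = sup0 {A_seminorm A (T x) | x. A_seminorm A x = 1}"

definition A_numerical_radius :: "('h::chilbert_space \<Rightarrow> 'h) \<Rightarrow> ('h \<Rightarrow> 'h) \<Rightarrow> real"
  where "A_numerical_radius A T = sup0 {cmod (A_inner A (T x) x) | x. A_seminorm A x = 1}"

definition A_spectral_radius :: "('h::chilbert_space \<Rightarrow> 'h) \<Rightarrow> ('h \<Rightarrow> 'h) \<Rightarrow> real"
  where "A_spectral_radius A T = (INF n\<in>{1..}. root n (A_opnorm A (T ^^ n)))"

end

theory Submission
  imports Defs
begin

text \<open>
  Put \<open>P = TS\<close>. On \<open>H \<times> H\<close> the operator matrix \<open>M\<close> with rows \<open>(P, PS)\<close> and \<open>(T, P)\<close> satisfies
  \<open>M N = N (2P)\<close> for \<open>N x = (Sx, x)\<close>, so powers of \<open>2P\<close> are dominated by powers of \<open>M\<close>. With respect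
  to the form \<open>aA \<oplus> A\<close>, with \<open>a = \<parallel>T\<parallel> / \<parallel>PS\<parallel>\<close>, the numerical radius of \<open>M\<close> is at most
  \<open>w = \<omega>(P) + (\<parallel>PS\<parallel> \<parallel>T\<parallel>)\<^sup>1\<^sup>/\<^sup>2\<close>. The power inequality \<open>\<omega>(M\<^sup>2) \<le> \<omega>(M)\<^sup>2\<close>, iterated, and
  \<open>\<parallel>X\<parallel> \<le> 2 \<omega>(X)\<close> bound the norm of \<open>M\<^sup>n\<close> by \<open>2 w\<^sup>n\<close> for \<open>n\<close> a power of two, whence \<open>2 r(P) \<le> w\<close>.
  Finally \<open>\<parallel>PS\<parallel>\<close> is at most both \<open>\<parallel>TS\<parallel> \<parallel>S\<parallel>\<close> and \<open>\<parallel>T\<parallel> \<parallel>S\<^sup>2\<parallel>\<close>.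
\<close>

section \<open>Complex Hilbert spaces and their products\<close>

lemma scaleC_one [simp]: "1 *\<^sub>C (x::'a::chilbert_space) = x"
  using scaleR_scaleC [of 1 x] by simp

lemma scaleC_two: "2 *\<^sub>C (x::'a::chilbert_space) = x + x"
  using scaleC_add_left [of 1 1 x] by simp

lemma cinner_add_right: "cinner x (y + z) = cinner x y + cinner x (z::'a::chilbert_space)"
  by (metis cinner_commute cinner_add_left complex_cnj_add)

lemma cinner_scaleC_right: "cinner x (c *\<^sub>C y) = cnj c * cinner x (y::'a::chilbert_space)"
  by (metis cinner_commute cinner_scaleC_left complex_cnj_mult)

text \<open>The operator matrix \<open>M\<close> acts on pairs, so everything shown for a positive
  operator has to be available on a product type. The norm on pairs is Euclidean, hence induced by
  the sum of the two inner products.\<close>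

instantiation prod :: (chilbert_space, chilbert_space) chilbert_space
begin

definition scaleC_prod :: "complex \<Rightarrow> 'a \<times> 'b \<Rightarrow> 'a \<times> 'b"
  where "scaleC_prod c z = (c *\<^sub>C fst z, c *\<^sub>C snd z)"

definition cinner_prod :: "'a \<times> 'b \<Rightarrow> 'a \<times> 'b \<Rightarrow> complex"
  where "cinner_prod z w = cinner (fst z) (fst w) + cinner (snd z) (snd w)"

instance
proof
  fix x y :: "'a \<times> 'b"
  show "cinner x y = cnj (cinner y x)"
    unfolding cinner_prod_def by (metis cinner_commute complex_cnj_add)
qed (simp_all add: scaleC_prod_def cinner_prod_def prod_eq_iff norm_prod_def algebra_simps
      scaleC_add_right scaleC_add_left scaleC_scaleC scaleR_scaleC cinner_add_left
      cinner_scaleC_left cinner_self flip: of_real_power)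

end

section \<open>Bounded and positive operators\<close>

lemma bounded_operator_add: "bounded_operator T \<Longrightarrow> T (x + y) = T x + T y"
  by (simp add: bounded_operator_def linear_add bounded_linear.linear)

lemma bounded_operator_scaleC: "bounded_operator T \<Longrightarrow> T (c *\<^sub>C x) = c *\<^sub>C T x"
  by (simp add: bounded_operator_def)

lemma bounded_operator_comp:
  "bounded_operator T \<Longrightarrow> bounded_operator S \<Longrightarrow> bounded_operator (T \<circ> S)"
  by (simp add: bounded_operator_def bounded_linear_compose o_def)

lemma bounded_operator_funpow: "bounded_operator T \<Longrightarrow> bounded_operator (T ^^ n)"
proof (induction n)
  case 0
  show ?case by (simp add: bounded_operator_def id_def)
next
  case (Suc n)
  then show ?case
    unfolding funpow.simps by (intro bounded_operator_comp)
qed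

text \<open>Combined with the scaling below, this makes the weighted form
  \<open>aA \<oplus> A\<close> on pairs the form of a positive operator.\<close>

lemma positive_operator_prod:
  fixes A :: "'h::chilbert_space \<Rightarrow> 'h" and B :: "'k::chilbert_space \<Rightarrow> 'k"
  assumes "positive_operator A" "positive_operator B"
  shows "positive_operator (\<lambda>z. (A (fst z), B (snd z)))"
  using assms unfolding positive_operator_def bounded_operator_def
  by (auto simp: scaleC_prod_def cinner_prod_def
      intro!: bounded_linear_Pair bounded_linear_compose [of A] bounded_linear_compose [of B]
        bounded_linear_fst bounded_linear_snd nonneg_Reals_add_I)

lemma positive_operator_scaleC:
  assumes "positive_operator A" "a \<ge> 0"
  shows "positive_operator (\<lambda>x. complex_of_real a *\<^sub>C A x)"
proof -
  have "bounded_linear (\<lambda>x. complex_of_real a *\<^sub>C A x)"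
    using assms unfolding positive_operator_def bounded_operator_def scaleR_scaleC [symmetric]
    by (intro bounded_linear_const_scaleR) simp
  then show ?thesis
    using assms unfolding positive_operator_def bounded_operator_def
    by (simp add: scaleC_scaleC mult.commute cinner_scaleC_left nonneg_Reals_mult_I)
qed

section \<open>The semi-inner product of a positive operator\<close>

context
  fixes A :: "'h::chilbert_space \<Rightarrow> 'h"
  assumes pos: "positive_operator A"
begin

lemma A_inner_add_left: "A_inner A (x + y) z = A_inner A x z + A_inner A y z"
  using pos by (simp add: A_inner_def positive_operator_def bounded_operator_add cinner_add_left)

lemma A_inner_add_right: "A_inner A x (y + z) = A_inner A x y + A_inner A x z"
  by (simp add: A_inner_def cinner_add_right)

lemma A_inner_scaleC_left: "A_inner A (c *\<^sub>C x) y = c * A_inner A x y"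
  using pos by (simp add: A_inner_def positive_operator_def bounded_operator_scaleC cinner_scaleC_left)

lemma A_inner_scaleC_right: "A_inner A x (c *\<^sub>C y) = cnj c * A_inner A x y"
  by (simp add: A_inner_def cinner_scaleC_right)

lemmas A_inner_linear =
  A_inner_add_left A_inner_add_right A_inner_scaleC_left A_inner_scaleC_right

lemma A_inner_self: "A_inner A x x = complex_of_real ((A_seminorm A x)\<^sup>2)"
proof -
  have "A_inner A x x \<in> \<real>\<^sub>\<ge>\<^sub>0"
    using pos by (simp add: A_inner_def positive_operator_def)
  then show ?thesis
    by (auto simp: A_seminorm_def complex_eq_iff complex_nonneg_Reals_iff)
qed

lemma A_seminorm_nonneg: "A_seminorm A x \<ge> 0"
proof -
  have "A_inner A x x \<in> \<real>\<^sub>\<ge>\<^sub>0"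
    using pos by (simp add: A_inner_def positive_operator_def)
  then show ?thesis
    by (simp add: A_seminorm_def complex_nonneg_Reals_iff)
qed

lemma A_seminorm_scaleC: "A_seminorm A (c *\<^sub>C x) = cmod c * A_seminorm A x"
proof -
  have "complex_of_real ((A_seminorm A (c *\<^sub>C x))\<^sup>2) = c * cnj c * A_inner A x x"
    by (simp only: A_inner_self [of "c *\<^sub>C x", symmetric] A_inner_linear mult_ac)
  also have "\<dots> = complex_of_real ((cmod c * A_seminorm A x)\<^sup>2)"
    by (simp only: A_inner_self complex_norm_square [symmetric] of_real_mult [symmetric]
        power_mult_distrib)
  finally have "(A_seminorm A (c *\<^sub>C x))\<^sup>2 = (cmod c * A_seminorm A x)\<^sup>2"
    using of_real_eq_iff by blast
  then show ?thesis
    by (simp add: A_seminorm_nonneg power2_eq_iff_nonneg)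
qed

lemma A_inner_commute: "A_inner A y x = cnj (A_inner A x y)"
proof -
  \<comment> \<open>A sesquilinear form that is real on the diagonal is Hermitian.\<close>
  have im: "Im (A_inner A z z) = 0" for z
    by (simp add: A_inner_self del: of_real_power)
  show ?thesis
    using im [of "x + y"] im [of "x + \<i> *\<^sub>C y"] im [of x] im [of y]
    by (simp add: A_inner_linear complex_eq_iff algebra_simps)
qed

text \<open>The form may be degenerate. The argument therefore expands the nonnegative square of the
  seminorm of \<open>r c x - s y\<close> for all real \<open>r\<close> and \<open>s\<close>, with a
  unimodular \<open>c\<close> that turns the cross term real.\<close>

lemma A_inner_Cauchy_Schwarz: "cmod (A_inner A x y) \<le> A_seminorm A x * A_seminorm A y"
proof -
  define z where "z = A_inner A x y"
  \<comment> \<open>Conjugate phase of \<open>z\<close>; the value 1 at \<open>z = 0\<close> keeps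
    \<open>c\<close> unimodular.\<close>
  define c where "c = (if z = 0 then 1 else cnj z / cmod z)"
  have c: "cmod c = 1" "c * z = cmod z"
    by (auto simp: c_def norm_divide complex_norm_square [symmetric] power2_eq_square field_simps)
  have quad: "2 * r * s * cmod z \<le> r\<^sup>2 * (A_seminorm A x)\<^sup>2 + s\<^sup>2 * (A_seminorm A y)\<^sup>2" for r s :: real
  proof -
    define v where "v = (complex_of_real r * c) *\<^sub>C x + complex_of_real (- s) *\<^sub>C y"
    have "A_inner A v v = r\<^sup>2 * (c * cnj c) * A_inner A x x + s\<^sup>2 * A_inner A y y
        - r * s * (c * z) - r * s * cnj (c * z)"
      unfolding v_def z_def
      by (simp add: A_inner_linear A_inner_commute [of y x] power2_eq_square algebra_simps)
    then have "complex_of_real ((A_seminorm A v)\<^sup>2) = complex_of_real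
        (r\<^sup>2 * (A_seminorm A x)\<^sup>2 + s\<^sup>2 * (A_seminorm A y)\<^sup>2 - 2 * r * s * cmod z)"
      unfolding A_inner_self c complex_norm_square [symmetric] by simp
    then have "(A_seminorm A v)\<^sup>2 = r\<^sup>2 * (A_seminorm A x)\<^sup>2 + s\<^sup>2 * (A_seminorm A y)\<^sup>2 - 2 * r * s * cmod z"
      using of_real_eq_iff by blast
    then show ?thesis
      using zero_le_power2 [of "A_seminorm A v"] by linarith
  qed
  \<comment> \<open>If \<open>x\<close> is a null vector, the term with \<open>r\<close> vanishes on
    the right of \<open>quad\<close>, so a large \<open>r\<close> forces \<open>z = 0\<close>.
    Otherwise \<open>r = cmod z\<close> and \<open>s\<close> the squared seminorm of
    \<open>x\<close> give the claim after cancelling that square.\<close>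
  have "(cmod z)\<^sup>2 \<le> (A_seminorm A x)\<^sup>2 * (A_seminorm A y)\<^sup>2"
  proof (cases "A_seminorm A x = 0")
    case True
    have "cmod z = 0"
    proof (rule ccontr)
      assume "cmod z \<noteq> 0"
      then have "2 * ((A_seminorm A y)\<^sup>2 + 1) \<le> (A_seminorm A y)\<^sup>2"
        using quad [of "((A_seminorm A y)\<^sup>2 + 1) / cmod z" 1] True by simp
      moreover have "(A_seminorm A y)\<^sup>2 \<ge> 0"
        by simp
      ultimately show False
        unfolding distrib_left by linarith
    qed
    then show ?thesis by simp
  next
    case False
    have "(A_seminorm A x)\<^sup>2 * (cmod z)\<^sup>2
        \<le> (A_seminorm A x)\<^sup>2 * ((A_seminorm A x)\<^sup>2 * (A_seminorm A y)\<^sup>2)"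
      using quad [of "cmod z" "(A_seminorm A x)\<^sup>2"]
      by (simp add: power2_eq_square algebra_simps)
    then show ?thesis
      by (rule mult_left_le_imp_le) (simp add: False)
  qed
  then show ?thesis
    by (simp add: z_def A_seminorm_nonneg power_mult_distrib [symmetric] power2_le_iff_abs_le)
qed

section \<open>Numerical bounds: powers and comparison with the seminorm\<close>

text \<open>For unimodular \<open>d\<close> the hypothesis says that \<open>w - dT\<close> has
  nonnegative real part with respect to the form. Adding this for \<open>d = c\<close> and
  \<open>d = - c\<close>, at suitable vectors, isolates the term with the square of
  \<open>T\<close>; the phase of \<open>c\<close> makes that term real.\<close>

lemma numerical_bound_square:
  assumes T: "bounded_operator T" and w: "w > 0"
    and bound: "\<And>x. cmod (A_inner A (T x) x) \<le> w * (A_seminorm A x)\<^sup>2"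
  shows "cmod (A_inner A (T (T x)) x) \<le> w\<^sup>2 * (A_seminorm A x)\<^sup>2"
proof -
  define z where "z = A_inner A (T (T x)) x"
  \<comment> \<open>A square root of the conjugate phase of \<open>z\<close>, because it is the
    square of \<open>c\<close> that multiplies \<open>z\<close> below.\<close>
  define c where "c = csqrt (if z = 0 then 1 else cnj z / cmod z)"
  have c: "c\<^sup>2 * z = cmod z"
    using complex_norm_square [of z]
    by (simp add: c_def mult.commute power2_eq_square [of "complex_of_real _"] divide_eq_eq)
  have "cmod (c\<^sup>2) = 1"
    by (auto simp: c_def norm_divide)
  then have c1: "cmod c = 1"
    by (simp add: norm_power power2_eq_1_iff) (metis norm_ge_zero not_one_le_zero neg_0_le_iff_le)
  have nonneg: "0 \<le> Re (A_inner A (complex_of_real w *\<^sub>C y + (- d) *\<^sub>C T y) y)"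
    if "cmod d = 1" for d y
  proof -
    have "Re (d * A_inner A (T y) y) \<le> w * (A_seminorm A y)\<^sup>2"
      using complex_Re_le_cmod [of "d * A_inner A (T y) y"] bound [of y] that
      by (simp add: norm_mult)
    then show ?thesis
      by (simp add: A_inner_linear A_inner_self del: of_real_power)
  qed
  define u v where "u = complex_of_real w *\<^sub>C x + c *\<^sub>C T x"
    and "v = complex_of_real w *\<^sub>C x + (- c) *\<^sub>C T x"
  \<comment> \<open>Both \<open>(w - cT)u\<close> and \<open>(w + cT)v\<close> equal \<open>(w\<^sup>2 - c\<^sup>2T\<^sup>2)x\<close>, and \<open>u + v = 2wx\<close>.\<close>
  have "A_inner A (complex_of_real w *\<^sub>C u + (- c) *\<^sub>C T u) u
      + A_inner A (complex_of_real w *\<^sub>C v + (- (- c)) *\<^sub>C T v) v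
      = 2 * w * (w\<^sup>2 * A_inner A x x - c\<^sup>2 * z)"
    unfolding u_def v_def z_def bounded_operator_add [OF T] bounded_operator_scaleC [OF T]
    by (simp add: A_inner_linear power2_eq_square algebra_simps)
  also have "\<dots> = complex_of_real (2 * w * (w\<^sup>2 * (A_seminorm A x)\<^sup>2 - cmod z))"
    by (simp add: c A_inner_self)
  finally have "0 \<le> 2 * w * (w\<^sup>2 * (A_seminorm A x)\<^sup>2 - cmod z)"
    using nonneg [of c u] nonneg [of "- c" v] c1
    by (metis Re_complex_of_real add_nonneg_nonneg norm_minus_cancel plus_complex.simps(1))
  then show ?thesis
    using w by (simp add: z_def zero_le_mult_iff)
qed

text \<open>Repeated squaring reaches only the exponents \<open>2 ^ m\<close>. These suffice,
  because every exponent gives an upper bound on the spectral radius.\<close>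

lemma numerical_bound_power:
  assumes T: "bounded_operator T" and w: "w > 0"
    and bound: "\<And>x. cmod (A_inner A (T x) x) \<le> w * (A_seminorm A x)\<^sup>2"
  shows "cmod (A_inner A ((T ^^ 2 ^ m) x) x) \<le> w ^ 2 ^ m * (A_seminorm A x)\<^sup>2"
proof (induction m arbitrary: x)
  case 0
  then show ?case by (simp add: bound)
next
  case (Suc m)
  have "cmod (A_inner A ((T ^^ 2 ^ m) ((T ^^ 2 ^ m) x)) x) \<le> (w ^ 2 ^ m)\<^sup>2 * (A_seminorm A x)\<^sup>2"
    by (intro numerical_bound_square bounded_operator_funpow T Suc.IH) (simp add: w)
  then show ?case
    by (simp add: mult_2 funpow_add power_add power2_eq_square)
qed

text \<open>Polarization expresses \<open>A_inner A (T x) v\<close> by four diagonal values of the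
  form of \<open>T\<close>; the parallelogram law sums their bounds to \<open>4 * w\<close> times
  the sum of the squared seminorms of \<open>x\<close> and \<open>v\<close>.\<close>

lemma seminorm_le_numerical_bound:
  assumes T: "bounded_operator T" and w: "w > 0"
    and bound: "\<And>x. cmod (A_inner A (T x) x) \<le> w * (A_seminorm A x)\<^sup>2"
  shows "A_seminorm A (T x) \<le> 2 * w * A_seminorm A x"
proof -
  define q where "q x = A_inner A (T x) x" for x
  \<comment> \<open>For \<open>v = t T x\<close> the estimate bounds \<open>t - w t^2\<close> times
    the squared seminorm of \<open>T x\<close>; this coefficient is largest at
    \<open>t = 1 / (2 * w)\<close>.\<close>
  define v where "v = complex_of_real (1 / (2 * w)) *\<^sub>C T x"
  have "4 * A_inner A (T x) v
      = q (x + v) - q (x + (- 1) *\<^sub>C v) + \<i> * q (x + \<i> *\<^sub>C v) - \<i> * q (x + (- \<i>) *\<^sub>C v)"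
    unfolding q_def bounded_operator_add [OF T] bounded_operator_scaleC [OF T]
    by (simp add: A_inner_linear algebra_simps)
  then have "cmod (4 * A_inner A (T x) v) = cmod
      (q (x + v) - q (x + (- 1) *\<^sub>C v) + (\<i> * q (x + \<i> *\<^sub>C v) - \<i> * q (x + (- \<i>) *\<^sub>C v)))"
    by (simp add: add_diff_eq)
  then have "4 * cmod (A_inner A (T x) v) \<le>
      cmod (q (x + v)) + cmod (q (x + (- 1) *\<^sub>C v)) + cmod (q (x + \<i> *\<^sub>C v)) + cmod (q (x + (- \<i>) *\<^sub>C v))"
    using norm_triangle_ineq4 [of "q (x + v)" "q (x + (- 1) *\<^sub>C v)"]
      norm_triangle_ineq4 [of "\<i> * q (x + \<i> *\<^sub>C v)" "\<i> * q (x + (- \<i>) *\<^sub>C v)"]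
      norm_triangle_ineq [of "q (x + v) - q (x + (- 1) *\<^sub>C v)"
        "\<i> * q (x + \<i> *\<^sub>C v) - \<i> * q (x + (- \<i>) *\<^sub>C v)"]
    by (simp add: norm_mult)
  also have "\<dots> \<le> w * ((A_seminorm A (x + v))\<^sup>2 + (A_seminorm A (x + (- 1) *\<^sub>C v))\<^sup>2
      + (A_seminorm A (x + \<i> *\<^sub>C v))\<^sup>2 + (A_seminorm A (x + (- \<i>) *\<^sub>C v))\<^sup>2)"
    unfolding q_def distrib_left by (intro add_mono bound)
  \<comment> \<open>The parallelogram law, used for \<open>x\<close> and \<open>v\<close> and again
    for \<open>x\<close> and \<open>\<i> *\<^sub>C v\<close>.\<close>
  also have "(A_seminorm A (x + v))\<^sup>2 + (A_seminorm A (x + (- 1) *\<^sub>C v))\<^sup>2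
      + (A_seminorm A (x + \<i> *\<^sub>C v))\<^sup>2 + (A_seminorm A (x + (- \<i>) *\<^sub>C v))\<^sup>2
      = 4 * ((A_seminorm A x)\<^sup>2 + (A_seminorm A v)\<^sup>2)"
  proof -
    have "(A_seminorm A (x + y))\<^sup>2 = Re (A_inner A (x + y) (x + y))" for x y
      by (simp add: A_inner_self del: of_real_power)
    moreover have "(A_seminorm A y)\<^sup>2 = Re (A_inner A y y)" for y
      by (simp add: A_inner_self del: of_real_power)
    ultimately show ?thesis
      by (simp only:) (simp add: A_inner_linear algebra_simps)
  qed
  finally have "cmod (A_inner A (T x) v) \<le> w * ((A_seminorm A x)\<^sup>2 + (A_seminorm A v)\<^sup>2)"
    by (simp add: distrib_left)
  moreover have "A_inner A (T x) v = complex_of_real ((A_seminorm A (T x))\<^sup>2 / (2 * w))"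
    by (simp add: v_def A_inner_linear A_inner_self)
  moreover have "(A_seminorm A v)\<^sup>2 = (A_seminorm A (T x))\<^sup>2 / (2 * w)\<^sup>2"
    using w by (simp add: v_def A_seminorm_scaleC power_mult_distrib power_divide norm_divide norm_mult)
  ultimately have "(A_seminorm A (T x))\<^sup>2 / (2 * w) \<le>
      w * ((A_seminorm A x)\<^sup>2 + (A_seminorm A (T x))\<^sup>2 / (2 * w)\<^sup>2)"
    using w by (simp add: norm_divide norm_mult norm_power)
  then have "(A_seminorm A (T x))\<^sup>2 \<le> (2 * w * A_seminorm A x)\<^sup>2"
    using w by (simp add: field_simps power2_eq_square)
  then show ?thesis
    using w by (simp add: A_seminorm_nonneg power2_le_iff_abs_le)
qed

section \<open>Operator seminorm and numerical radius as best constants\<close>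

lemma A_opnorm_bdd_above: "A_bounded A T \<Longrightarrow> bdd_above {A_seminorm A (T x) | x. A_seminorm A x = 1}"
  unfolding A_bounded_def bdd_above_def by clarsimp (metis mult.right_neutral)

lemma A_opnorm_upper:
  assumes "A_bounded A T"
  shows "A_seminorm A (T x) \<le> A_opnorm A T * A_seminorm A x"
proof (cases "A_seminorm A x = 0")
  \<comment> \<open>A null vector cannot be normalized, but an \<open>A\<close>-bounded operator
    maps it to a null vector.\<close>
  case True
  then show ?thesis
    using assms A_seminorm_nonneg [of "T x"] unfolding A_bounded_def by (metis mult_zero_right)
next
  case False
  define y where "y = complex_of_real (1 / A_seminorm A x) *\<^sub>C x"
  have y: "A_seminorm A y = 1"
    using False A_seminorm_nonneg [of x] by (simp add: y_def A_seminorm_scaleC norm_divide)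
  then have "A_seminorm A (T y) \<le> A_opnorm A T"
    unfolding A_opnorm_def sup0_def
    using A_opnorm_bdd_above [OF assms] by (auto intro!: cSup_upper)
  moreover have "A_seminorm A (T y) = A_seminorm A (T x) / A_seminorm A x"
    using assms A_seminorm_nonneg [of x]
    by (simp add: y_def A_bounded_def bounded_operator_scaleC A_seminorm_scaleC norm_divide)
  ultimately show ?thesis
    using False A_seminorm_nonneg [of x] by (simp add: divide_le_eq)
qed

text \<open>The premise \<open>c \<ge> 0\<close> settles the case of an empty unit sphere, where the
  norm is 0 by convention.\<close>

lemma A_opnorm_least:
  assumes "c \<ge> 0" "\<And>x. A_seminorm A (T x) \<le> c * A_seminorm A x"
  shows "A_opnorm A T \<le> c"
  unfolding A_opnorm_def sup0_def using assms(1)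
  by (auto intro!: cSup_least) (metis assms(2) mult.right_neutral)

lemma A_opnorm_nonneg:
  assumes "A_bounded A T"
  shows "A_opnorm A T \<ge> 0"
proof (cases "\<exists>x. A_seminorm A x = 1")
  case True
  then obtain x where "A_seminorm A x = 1" by blast
  then show ?thesis
    using A_opnorm_upper [OF assms, of x] A_seminorm_nonneg [of "T x"] by simp
qed (simp add: A_opnorm_def sup0_def)

lemma A_bounded_comp:
  assumes "A_bounded A T" "A_bounded A S"
  shows "A_bounded A (T \<circ> S)"
proof -
  obtain c d where "c > 0" "d > 0" and c: "\<And>x. A_seminorm A (T x) \<le> c * A_seminorm A x"
    and d: "\<And>x. A_seminorm A (S x) \<le> d * A_seminorm A x"
    using assms unfolding A_bounded_def by blast
  have "A_seminorm A (T (S x)) \<le> (c * d) * A_seminorm A x" for x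
    using order_trans [OF c mult_left_mono [OF d]] \<open>c > 0\<close> by (simp add: mult.assoc)
  then show ?thesis
    using assms \<open>c > 0\<close> \<open>d > 0\<close> unfolding A_bounded_def
    by (auto simp: bounded_operator_comp intro!: exI [of _ "c * d"])
qed

lemma A_bounded_funpow:
  assumes "A_bounded A T"
  shows "A_bounded A (T ^^ n)"
proof (induction n)
  case 0
  then show ?case
    by (auto simp: A_bounded_def bounded_operator_def id_def intro!: exI [of _ 1])
next
  case (Suc n)
  then show ?case
    unfolding funpow.simps by (intro A_bounded_comp assms)
qed

lemma A_opnorm_comp:
  assumes "A_bounded A T" "A_bounded A S"
  shows "A_opnorm A (T \<circ> S) \<le> A_opnorm A T * A_opnorm A S"
proof (rule A_opnorm_least)
  fix x
  show "A_seminorm A ((T \<circ> S) x) \<le> A_opnorm A T * A_opnorm A S * A_seminorm A x"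
    using A_opnorm_upper [OF assms(1), of "S x"]
      mult_left_mono [OF A_opnorm_upper [OF assms(2), of x] A_opnorm_nonneg [OF assms(1)]]
    by (simp add: mult.assoc)
qed (simp add: A_opnorm_nonneg assms)

lemma A_numerical_radius_upper:
  assumes "A_bounded A T"
  shows "cmod (A_inner A (T x) x) \<le> A_numerical_radius A T * (A_seminorm A x)\<^sup>2"
proof (cases "A_seminorm A x = 0")
  case True
  then show ?thesis
    using A_inner_Cauchy_Schwarz [of "T x" x] by simp
next
  case False
  define y where "y = complex_of_real (1 / A_seminorm A x) *\<^sub>C x"
  have y: "A_seminorm A y = 1"
    using False A_seminorm_nonneg [of x] by (simp add: y_def A_seminorm_scaleC norm_divide)
  \<comment> \<open>By Cauchy-Schwarz the operator seminorm bounds these values on the unit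
    sphere.\<close>
  have "bdd_above {cmod (A_inner A (T x) x) | x. A_seminorm A x = 1}"
    unfolding bdd_above_def
    using A_inner_Cauchy_Schwarz A_opnorm_upper [OF assms]
    by (auto intro!: exI [of _ "A_opnorm A T"]) (metis mult.right_neutral order_trans)
  then have "cmod (A_inner A (T y) y) \<le> A_numerical_radius A T"
    unfolding A_numerical_radius_def sup0_def using y by (auto intro!: cSup_upper)
  moreover have "cmod (A_inner A (T y) y) = cmod (A_inner A (T x) x) / (A_seminorm A x)\<^sup>2"
    using assms A_seminorm_nonneg [of x]
    by (simp add: y_def A_bounded_def bounded_operator_scaleC A_inner_linear norm_divide norm_mult
        power2_eq_square)
  ultimately show ?thesis
    using False A_seminorm_nonneg [of x] by (simp add: divide_le_eq)
qed

lemma A_numerical_radius_nonneg: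
  assumes "A_bounded A T"
  shows "A_numerical_radius A T \<ge> 0"
proof (cases "\<exists>x. A_seminorm A x = 1")
  case True
  then obtain x where "A_seminorm A x = 1" by blast
  then show ?thesis
    using A_numerical_radius_upper [OF assms, of x] norm_ge_zero [of "A_inner A (T x) x"]
    by (metis mult.right_neutral order_trans power_one)
qed (simp add: A_numerical_radius_def sup0_def)

section \<open>Upper bounds for the spectral radius\<close>

lemma A_spectral_radius_le_root:
  assumes "A_bounded A T" "n \<ge> 1"
  shows "A_spectral_radius A T \<le> root n (A_opnorm A (T ^^ n))"
  unfolding A_spectral_radius_def using assms
  by (intro cINF_lower bdd_belowI [of _ 0]) (auto simp: A_opnorm_nonneg A_bounded_funpow)

text \<open>A constant factor independent of the exponent is harmless: its root of order
  \<open>2 ^ m\<close> tends to 1.\<close>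

lemma A_spectral_radius_le:
  assumes T: "A_bounded A T" and "C \<ge> 0" "w \<ge> 0"
    and bound: "\<And>m x. A_seminorm A ((T ^^ 2 ^ m) x) \<le> C * w ^ 2 ^ m * A_seminorm A x"
  shows "A_spectral_radius A T \<le> w"
proof (rule LIMSEQ_le_const)
  \<comment> \<open>\<open>C\<close> may be 0, whose roots do not tend to 1; hence
    \<open>C + 1\<close>.\<close>
  have "(\<lambda>n. root n (C + 1)) \<longlonglongrightarrow> 1"
    using \<open>C \<ge> 0\<close> by (intro LIMSEQ_root_const) simp
  then have "(\<lambda>m. root (2 ^ m) (C + 1)) \<longlonglongrightarrow> 1"
    by (rule filterlim_compose) (rule filterlim_subseq, simp add: strict_mono_def)
  then show "(\<lambda>m. root (2 ^ m) (C + 1) * w) \<longlonglongrightarrow> w"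
    using tendsto_mult_right [of _ 1 _ w] by simp
  have "A_spectral_radius A T \<le> root (2 ^ m) (C + 1) * w" for m
  proof -
    have "A_opnorm A (T ^^ 2 ^ m) \<le> C * w ^ 2 ^ m"
      using assms by (intro A_opnorm_least) auto
    also have "\<dots> \<le> (C + 1) * w ^ 2 ^ m"
      using assms by (intro mult_right_mono) auto
    finally have "root (2 ^ m) (A_opnorm A (T ^^ 2 ^ m)) \<le> root (2 ^ m) (C + 1) * w"
      using \<open>w \<ge> 0\<close> by (metis real_root_le_mono real_root_mult real_root_power_cancel
          zero_less_numeral zero_less_power)
    then show ?thesis
      using A_spectral_radius_le_root [OF T, of "2 ^ m"] by simp
  qed
  then show "\<exists>N. \<forall>m\<ge>N. A_spectral_radius A T \<le> root (2 ^ m) (C + 1) * w"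
    by blast
qed

end

section \<open>The operator matrix on pairs\<close>

text \<open>Positive upper bounds \<open>p\<close> and \<open>q\<close> stand in for the two norms,
  either of which may vanish, so that the weight \<open>q / p\<close> is defined and
  positive.\<close>

lemma A_spectral_radius_comp_le_of_bounds:
  fixes A T S :: "'h::chilbert_space \<Rightarrow> 'h"
  assumes pos: "positive_operator A" and T: "A_bounded A T" and S: "A_bounded A S"
    and comm: "T \<circ> S = S \<circ> T" and "p > 0" "q > 0"
    and p: "A_opnorm A (T \<circ> S \<circ> S) \<le> p" and q: "A_opnorm A T \<le> q"
  shows "A_spectral_radius A (T \<circ> S) \<le> 1 / 2 * (A_numerical_radius A (T \<circ> S) + sqrt (p * q))"
proof -
  define a where "a = q / p"
  define B :: "'h \<times> 'h \<Rightarrow> 'h \<times> 'h" where "B = (\<lambda>z. (complex_of_real a *\<^sub>C A (fst z), A (snd z)))"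
  define M where "M = (\<lambda>(x, y). (T (S x) + T (S (S y)), T x + T (S y)))"
  define w where "w = A_numerical_radius A (T \<circ> S) + sqrt (p * q)"
  have TS: "A_bounded A (T \<circ> S)" and TSS: "A_bounded A (T \<circ> S \<circ> S)"
    by (simp_all add: A_bounded_comp [OF pos] T S)
  have lin: "bounded_operator T" "bounded_operator S"
    using T S by (simp_all add: A_bounded_def)
  have "a > 0" "w > 0"
    using \<open>p > 0\<close> \<open>q > 0\<close> A_numerical_radius_nonneg [OF pos TS]
    by (auto simp: a_def w_def intro!: add_nonneg_pos)
  have B: "positive_operator B"
    unfolding B_def using \<open>a > 0\<close> by (intro positive_operator_prod positive_operator_scaleC pos) simp
  have B_inner: "A_inner B u v = a * A_inner A (fst u) (fst v) + A_inner A (snd u) (snd v)" for u v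
    by (simp add: B_def A_inner_def cinner_prod_def cinner_scaleC_left)
  have B_norm: "(A_seminorm B z)\<^sup>2 = a * (A_seminorm A (fst z))\<^sup>2 + (A_seminorm A (snd z))\<^sup>2" for z
  proof -
    have "complex_of_real ((A_seminorm B z)\<^sup>2) =
        complex_of_real (a * (A_seminorm A (fst z))\<^sup>2 + (A_seminorm A (snd z))\<^sup>2)"
      using A_inner_self [OF B, of z] by (simp add: B_inner A_inner_self [OF pos])
    then show ?thesis
      using of_real_eq_iff by blast
  qed
  have M: "bounded_operator M"
    using lin unfolding bounded_operator_def M_def case_prod_unfold
    by (auto simp: scaleC_prod_def scaleC_add_right
        intro!: bounded_linear_Pair bounded_linear_add bounded_linear_compose [of T]
          bounded_linear_compose [of S] bounded_linear_fst bounded_linear_snd)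
  \<comment> \<open>The diagonal entries of \<open>M\<close> are controlled by the numerical radius
    of \<open>T \<circ> S\<close>, the off-diagonal ones by Cauchy-Schwarz with \<open>p\<close> and
    \<open>q\<close>.\<close>
  have bound: "cmod (A_inner B (M z) z) \<le> w * (A_seminorm B z)\<^sup>2" for z
  proof -
    obtain x y where z: "z = (x, y)" by (cases z)
    define \<xi> \<eta> where "\<xi> = A_seminorm A x" and "\<eta> = A_seminorm A y"
    have nn: "\<xi> \<ge> 0" "\<eta> \<ge> 0"
      by (simp_all add: \<xi>_def \<eta>_def A_seminorm_nonneg [OF pos])
    have x: "cmod (A_inner A (T (S x)) x) \<le> A_numerical_radius A (T \<circ> S) * \<xi>\<^sup>2"
      and y: "cmod (A_inner A (T (S y)) y) \<le> A_numerical_radius A (T \<circ> S) * \<eta>\<^sup>2"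
      using A_numerical_radius_upper [OF pos TS] by (simp_all add: \<xi>_def \<eta>_def)
    have "A_seminorm A (T (S (S y))) \<le> p * \<eta>"
      using A_opnorm_upper [OF pos TSS, of y] mult_right_mono [OF p nn(2)] by (simp add: \<eta>_def)
    then have yx: "cmod (A_inner A (T (S (S y))) x) \<le> p * \<eta> * \<xi>"
      using A_inner_Cauchy_Schwarz [OF pos, of "T (S (S y))" x] nn
      by (metis \<xi>_def mult_right_mono order_trans)
    have "A_seminorm A (T x) \<le> q * \<xi>"
      using A_opnorm_upper [OF pos T, of x] mult_right_mono [OF q nn(1)] by (simp add: \<xi>_def)
    then have xy: "cmod (A_inner A (T x) y) \<le> q * \<xi> * \<eta>"
      using A_inner_Cauchy_Schwarz [OF pos, of "T x" y] nn
      by (metis \<eta>_def mult_right_mono order_trans)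
    \<comment> \<open>The weight \<open>a = q / p\<close> makes both off-diagonal entries contribute \<open>q * \<xi> * \<eta>\<close>.\<close>
    have "2 * (q * \<xi> * \<eta>) = sqrt (p * q) * (2 * (sqrt a * \<xi>) * \<eta>)"
      using \<open>p > 0\<close> \<open>q > 0\<close> by (simp add: a_def real_sqrt_mult real_sqrt_divide)
    \<comment> \<open>With \<open>sqrt a\<close> absorbed into the first factor, the
      arithmetic-geometric mean inequality produces exactly the squared \<open>B\<close>-seminorm of
      \<open>z\<close>.\<close>
    also have "\<dots> \<le> sqrt (p * q) * ((sqrt a * \<xi>)\<^sup>2 + \<eta>\<^sup>2)"
      using \<open>p > 0\<close> \<open>q > 0\<close> by (intro mult_left_mono sum_squares_bound) simp
    finally have off: "2 * (q * \<xi> * \<eta>) \<le> sqrt (p * q) * (a * \<xi>\<^sup>2 + \<eta>\<^sup>2)"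
      using \<open>a > 0\<close> by (simp add: power_mult_distrib)
    have "A_inner B (M z) z = a * A_inner A (T (S x)) x + a * A_inner A (T (S (S y))) x
        + A_inner A (T x) y + A_inner A (T (S y)) y"
      by (simp add: z M_def B_inner A_inner_add_left [OF pos] algebra_simps)
    also have "cmod \<dots> \<le> a * cmod (A_inner A (T (S x)) x) + a * cmod (A_inner A (T (S (S y))) x)
        + cmod (A_inner A (T x) y) + cmod (A_inner A (T (S y)) y)"
      using \<open>a > 0\<close> by (intro norm_triangle_mono) (simp_all add: norm_mult)
    also have "\<dots> \<le> a * (A_numerical_radius A (T \<circ> S) * \<xi>\<^sup>2) + a * (p * \<eta> * \<xi>)
        + q * \<xi> * \<eta> + A_numerical_radius A (T \<circ> S) * \<eta>\<^sup>2"
      using \<open>a > 0\<close> by (intro add_mono mult_left_mono x y xy yx) simp_all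
    also have "\<dots> = A_numerical_radius A (T \<circ> S) * (a * \<xi>\<^sup>2 + \<eta>\<^sup>2) + 2 * (q * \<xi> * \<eta>)"
      using \<open>p > 0\<close> by (simp add: a_def algebra_simps)
    also have "\<dots> \<le> w * (a * \<xi>\<^sup>2 + \<eta>\<^sup>2)"
      using off by (simp add: w_def algebra_simps)
    finally show ?thesis
      by (simp add: z B_norm \<xi>_def \<eta>_def)
  qed
  have swap: "S (T x) = T (S x)" for x
    using comm by (metis comp_apply)
  \<comment> \<open>The set of pairs \<open>(S v, v)\<close> is invariant under \<open>M\<close>: on
    it the two summands in each row coincide by commutativity, so \<open>M\<close> acts there as
    twice \<open>T \<circ> S\<close>.\<close>
  have intertwine: "(M ^^ n) (S x, x) =
      complex_of_real (2 ^ n) *\<^sub>C (S (((T \<circ> S) ^^ n) x), ((T \<circ> S) ^^ n) x)" for n x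
  proof (induction n)
    case (Suc n)
    have "M (S v, v) = complex_of_real 2 *\<^sub>C (S (T (S v)), T (S v))" for v
      by (simp add: M_def scaleC_prod_def swap scaleC_two)
    with Suc show ?case
      by (simp add: bounded_operator_scaleC [OF M] scaleC_scaleC mult.commute)
  qed (simp add: scaleC_prod_def)
  \<comment> \<open>The factor 2 is the price of passing from numerical bound to seminorm; the root
    bounds the map taking \<open>x\<close> to \<open>(S x, x)\<close>. Neither depends on
    \<open>m\<close>.\<close>
  define C where "C = 2 * sqrt (a * (A_opnorm A S)\<^sup>2 + 1)"
  have "A_seminorm A (((T \<circ> S) ^^ 2 ^ m) x) \<le> C * (w / 2) ^ 2 ^ m * A_seminorm A x" for m x
  proof -
    define n :: nat where "n = 2 ^ m"
    \<comment> \<open>Projection to the second coordinate recovers the power of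
      \<open>T \<circ> S\<close> and does not increase the seminorm.\<close>
    have "A_seminorm A (snd z) \<le> A_seminorm B z" for z
      using B_norm [of z] \<open>a > 0\<close> A_seminorm_nonneg [OF B, of z]
      by (auto intro: power2_le_imp_le)
    from this [of "(M ^^ n) (S x, x)"]
    have "2 ^ n * A_seminorm A (((T \<circ> S) ^^ n) x) \<le> A_seminorm B ((M ^^ n) (S x, x))"
      by (simp add: intertwine scaleC_prod_def A_seminorm_scaleC [OF pos] norm_power)
    also have "\<dots> \<le> 2 * w ^ n * A_seminorm B (S x, x)"
      unfolding n_def using \<open>w > 0\<close>
      by (intro seminorm_le_numerical_bound [OF B] bounded_operator_funpow [OF M]
          numerical_bound_power [OF B M _ bound]) simp_all
    also have "A_seminorm B (S x, x) \<le> sqrt (a * (A_opnorm A S)\<^sup>2 + 1) * A_seminorm A x"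
    proof (rule power2_le_imp_le)
      have "(A_seminorm A (S x))\<^sup>2 \<le> (A_opnorm A S * A_seminorm A x)\<^sup>2"
        by (intro power_mono A_opnorm_upper A_seminorm_nonneg pos S)
      then have "a * (A_seminorm A (S x))\<^sup>2 \<le> a * (A_opnorm A S * A_seminorm A x)\<^sup>2"
        using \<open>a > 0\<close> by simp
      then show "(A_seminorm B (S x, x))\<^sup>2 \<le> (sqrt (a * (A_opnorm A S)\<^sup>2 + 1) * A_seminorm A x)\<^sup>2"
        using \<open>a > 0\<close> by (simp add: B_norm power_mult_distrib algebra_simps)
    qed (use \<open>a > 0\<close> A_seminorm_nonneg [OF pos] in simp)
    finally have "2 ^ n * A_seminorm A (((T \<circ> S) ^^ n) x) \<le> w ^ n * C * A_seminorm A x"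
      using \<open>w > 0\<close> by (simp add: C_def algebra_simps)
    \<comment> \<open>Dividing by \<open>2 ^ n\<close> turns \<open>w ^ n\<close> into
      \<open>(w / 2) ^ n\<close>, the source of the factor 1/2 in the final bounds.\<close>
    then show ?thesis
      by (simp add: n_def [symmetric] power_divide field_simps)
  qed
  then have "A_spectral_radius A (T \<circ> S) \<le> w / 2"
    using \<open>w > 0\<close> \<open>a > 0\<close> by (intro A_spectral_radius_le [OF pos TS, of C]) (auto simp: C_def)
  then show ?thesis
    by (simp add: w_def)
qed

section \<open>Passage to the norms and the two inequalities\<close>

text \<open>The previous bound applies with \<open>e > 0\<close> added to both norms; letting
  \<open>e\<close> tend to 0 from the right removes the positivity requirement.\<close>

lemma A_spectral_radius_comp_le:
  fixes A T S :: "'h::chilbert_space \<Rightarrow> 'h"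
  assumes pos: "positive_operator A" and T: "A_bounded A T" and S: "A_bounded A S"
    and comm: "T \<circ> S = S \<circ> T"
  shows "A_spectral_radius A (T \<circ> S) \<le>
    1 / 2 * (A_numerical_radius A (T \<circ> S) + sqrt (A_opnorm A (T \<circ> S \<circ> S) * A_opnorm A T))"
proof (rule tendsto_lowerbound)
  let ?f = "\<lambda>e. 1 / 2 * (A_numerical_radius A (T \<circ> S)
    + sqrt ((A_opnorm A (T \<circ> S \<circ> S) + e) * (A_opnorm A T + e)))"
  have "(?f \<longlongrightarrow> 1 / 2 * (A_numerical_radius A (T \<circ> S)
    + sqrt ((A_opnorm A (T \<circ> S \<circ> S) + 0) * (A_opnorm A T + 0)))) (at_right 0)"
    by (intro tendsto_intros)
  then show "(?f \<longlongrightarrow> 1 / 2 * (A_numerical_radius A (T \<circ> S)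
    + sqrt (A_opnorm A (T \<circ> S \<circ> S) * A_opnorm A T))) (at_right 0)"
    by simp
  show "\<forall>\<^sub>F e in at_right 0. A_spectral_radius A (T \<circ> S) \<le> ?f e"
    using eventually_at_right_less
  proof eventually_elim
    case (elim e)
    have "A_opnorm A (T \<circ> S \<circ> S) \<ge> 0" "A_opnorm A T \<ge> 0"
      by (intro A_opnorm_nonneg A_bounded_comp pos T S)+
    then show ?case
      using elim by (intro A_spectral_radius_comp_le_of_bounds pos T S comm) auto
  qed
qed simp

text \<open>Grouping the triple product as \<open>T\<close> times the square of \<open>S\<close>
  leaves the squared norm of \<open>T\<close> under the root.\<close>

lemma A_spectral_radius_comp_le_square:
  fixes A T S :: "'h::chilbert_space \<Rightarrow> 'h"
  assumes pos: "positive_operator A" and T: "A_bounded A T" and S: "A_bounded A S"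
    and comm: "T \<circ> S = S \<circ> T"
  shows "A_spectral_radius A (T \<circ> S) \<le>
    1 / 2 * (A_numerical_radius A (T \<circ> S) + A_opnorm A T * sqrt (A_opnorm A (S ^^ 2)))"
proof -
  have "A_opnorm A (T \<circ> S \<circ> S) \<le> A_opnorm A T * A_opnorm A (S ^^ 2)"
    using A_opnorm_comp [OF pos T A_bounded_funpow [OF pos S, of 2]]
    by (simp add: numeral_2_eq_2 comp_assoc)
  then have "sqrt (A_opnorm A (T \<circ> S \<circ> S) * A_opnorm A T)
      \<le> sqrt ((A_opnorm A T)\<^sup>2 * A_opnorm A (S ^^ 2))"
    using mult_right_mono [OF _ A_opnorm_nonneg [OF pos T]]
    by (fastforce simp: power2_eq_square algebra_simps)
  also have "\<dots> = A_opnorm A T * sqrt (A_opnorm A (S ^^ 2))"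
    by (simp add: real_sqrt_mult A_opnorm_nonneg [OF pos T])
  finally show ?thesis
    using A_spectral_radius_comp_le [OF assms] by simp
qed

theorem corollary2p6:
  fixes A T S :: "'h::chilbert_space \<Rightarrow> 'h"
  assumes "positive_operator A"
    and "A_bounded A T"
    and "A_bounded A S"
    and "T \<circ> S = S \<circ> T"
  shows "A_spectral_radius A (T \<circ> S) \<le>
      1 / 2 * (A_numerical_radius A (T \<circ> S)
        + sqrt (A_opnorm A T) * sqrt (A_opnorm A S) * sqrt (A_opnorm A (T \<circ> S)))
    \<and> A_spectral_radius A (T \<circ> S) \<le>
      1 / 2 * (A_numerical_radius A (T \<circ> S)
        + min (A_opnorm A T * sqrt (A_opnorm A (S ^^ 2)))
              (sqrt (A_opnorm A (T ^^ 2)) * A_opnorm A S))"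
proof -
  note pos = assms(1) and T = assms(2) and S = assms(3) and comm = assms(4)
  have TS: "A_bounded A (T \<circ> S)"
    by (intro A_bounded_comp pos T S)
  \<comment> \<open>The first inequality groups the triple product the other way, as
    \<open>T \<circ> S\<close> times \<open>S\<close>.\<close>
  have "A_opnorm A (T \<circ> S \<circ> S) * A_opnorm A T \<le> A_opnorm A (T \<circ> S) * A_opnorm A S * A_opnorm A T"
    by (intro mult_right_mono A_opnorm_comp A_opnorm_nonneg pos T S TS)
  then have "sqrt (A_opnorm A (T \<circ> S \<circ> S) * A_opnorm A T)
      \<le> sqrt (A_opnorm A (T \<circ> S) * A_opnorm A S * A_opnorm A T)"
    by simp
  also have "\<dots> = sqrt (A_opnorm A T) * sqrt (A_opnorm A S) * sqrt (A_opnorm A (T \<circ> S))"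
    by (simp add: real_sqrt_mult mult_ac)
  finally have "A_spectral_radius A (T \<circ> S) \<le> 1 / 2 * (A_numerical_radius A (T \<circ> S)
      + sqrt (A_opnorm A T) * sqrt (A_opnorm A S) * sqrt (A_opnorm A (T \<circ> S)))"
    using A_spectral_radius_comp_le [OF assms] by simp
  \<comment> \<open>Exchanging \<open>T\<close> and \<open>S\<close> gives the other entry of the
    minimum; commutativity identifies the two products.\<close>
  moreover have "A_spectral_radius A (T \<circ> S) \<le> 1 / 2 * (A_numerical_radius A (T \<circ> S)
      + sqrt (A_opnorm A (T ^^ 2)) * A_opnorm A S)"
    using A_spectral_radius_comp_le_square [OF pos S T comm [symmetric]]
    unfolding comm by (simp add: mult.commute)
  ultimately show ?thesis
    using A_spectral_radius_comp_le_square [OF assms] by (simp add: min_def)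
qed

end
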